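(* Let $(X,\langle\cdot,\cdot\rangle)$ be an infinite-dimensional real Hilbert space and let $J:X\to\mathbb{R}$ be a functional of class $C^2$ whose derivative $J':X\to X$ is a compact operator. For each $\lambda\in\mathbb{R}$ put $$A_\lambda=\{x\in X:\ y=\lambda J''(x)(y)\ \text{for some } y\in X\setminus\{0\}\}.$$ Put $$M=\max\left\{0,\ 2\limsup_{\|x\|\to+\infty}\frac{J(x)}{\|x\|^2},\ \limsup_{\|x\|\to+\infty}\frac{\langle J'(x),x\rangle}{\|x\|^2}\right\}$$ and assume $$M<\sup_{(x,y)\in X\times(X\setminus\{0\})}\frac{\langle J''(x)(y),y\rangle}{\|y\|^2}.$$ Then for every $\lambda$ satisfying $$\inf_{\{(x,y)\in X\times X:\ \langle J''(x)(y),y\rangle>0\}}\frac{\|y\|^2}{\langle J''(x)(y),y\rangle}<\lambda<\frac1M,$$ the set $A_\lambda$ is closed and not $\sigma$-compact in $X$.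
   Context: $J'(x)\in X$ is identified with the gradient via the Riesz representation, and $J''(x)$ is a bounded linear operator $X\to X$. A compact operator here means a continuous map sending bounded sets to relatively compact sets. Convention: $\frac10=+\infty$. A set in a topological space is $\sigma$-compact if it is the union of an at most countable family of compact sets. *)

theory Defs
  imports "HOL-Analysis.Analysis"
begin

definition sigma_compact :: "'a::topological_space set \<Rightarrow> bool" where
  "sigma_compact S \<longleftrightarrow> (\<exists>F. countable F \<and> (\<forall>K\<in>F. compact K) \<and> \<Union>F = S)"

definition compact_map :: "('a::real_normed_vector \<Rightarrow> 'b::real_normed_vector) \<Rightarrow> bool" where
  "compact_map f \<longleftrightarrow> continuous_on UNIV f \<and> (\<forall>S. bounded S \<longrightarrow> compact (closure (f ` S)))"

definition ereal_recip :: "ereal \<Rightarrow> ereal" where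
  "ereal_recip M = (if M = 0 then \<infinity> else if M = \<infinity> then 0 else ereal (1 / real_of_ereal M))"

end

theory Submission
  imports Defs
begin

text \<open>
  Write \<open>G = \<lambda>J\<close>, \<open>g = \<lambda>J'\<close>, \<open>H = \<lambda>J''\<close>, and let \<open>S\<close> be the set of points at which the
  self-adjoint operator \<open>I - H x\<close> has a kernel. As \<open>H x\<close> is compact, the complement of \<open>S\<close> is
  covered by two disjoint open sets: the points where \<open>I - H x\<close> takes a negative value (a nonempty
  set by the lower bound on \<open>\<lambda>\<close>) and those where it is coercive. In infinite dimension a
  \<open>\<sigma>\<close>-compact set has empty interior and connected complement, so if \<open>S\<close> were \<open>\<sigma>\<close>-compact, then
  \<open>I - H x\<close> would be coercive nowhere. But by the upper bound on \<open>\<lambda>\<close>, for every \<open>v\<close> the functional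
  \<open>\<parallel>x\<parallel>\<^sup>2/2 - G x - \<langle>v, x\<rangle>\<close> attains its minimum at some \<open>x\<close>; there \<open>I - H x \<ge> 0\<close> and
  \<open>x - g x = v\<close>. Hence \<open>x\<close> lies in \<open>S\<close>, and the continuous image of \<open>S\<close> under \<open>I - g\<close>
  is the whole space, which is not \<open>\<sigma>\<close>-compact.
\<close>

subsection \<open>Sigma-compact sets in infinite dimension\<close>

text \<open>Gram-Schmidt, one generator at a time: \<open>r\<close> is the part of the new vector
  \<open>b\<close> orthogonal to \<open>span B\<close>, and the projection gains the component of
  \<open>x\<close> along \<open>r\<close>.\<close>

lemma orthogonal_projection_finite_span:
  fixes B :: "'a::real_inner set"
  assumes "finite B"
  shows "\<exists>p\<in>span B. \<forall>b\<in>span B. inner (x - p) b = 0"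
  using assms
proof (induction B arbitrary: x rule: finite_induct)
  case empty
  then show ?case by simp
next
  case (insert b B)
  obtain p where p: "p \<in> span B" "\<And>c. c \<in> span B \<Longrightarrow> inner (x - p) c = 0"
    using insert.IH by blast
  obtain q where q: "q \<in> span B" "\<And>c. c \<in> span B \<Longrightarrow> inner (b - q) c = 0"
    using insert.IH by blast
  define r where "r = b - q"
  \<comment> \<open>If \<open>b\<close> already lies in \<open>span B\<close>, then
    \<open>r = 0\<close>, the quotient is \<open>0\<close> by the convention for division by zero,
    and \<open>p' = p\<close> remains correct.\<close>
  define p' where "p' = p + (inner x r / inner r r) *\<^sub>R r"
  have sub: "span B \<subseteq> span (insert b B)" by (simp add: span_mono subset_insertI)
  have "r \<in> span (insert b B)"
    unfolding r_def using q(1) sub by (simp add: span_base span_diff subsetD)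
  then have mem: "p' \<in> span (insert b B)"
    unfolding p'_def using p(1) sub by (simp add: span_add span_scale subsetD)
  have "inner (x - p') c = 0" if c: "c \<in> span (insert b B)" for c
  proof -
    obtain k where k: "c - k *\<^sub>R b \<in> span B" using c span_breakdown_eq by blast
    define d where "d = (c - k *\<^sub>R b) + k *\<^sub>R q"
    have d: "d \<in> span B" unfolding d_def using k q(1) by (simp add: span_add span_scale)
    have ceq: "c = d + k *\<^sub>R r" unfolding d_def r_def by (simp add: algebra_simps)
    have 1: "inner (x - p') d = 0"
      using p(2)[OF d] q(2)[OF d] unfolding p'_def r_def by (simp add: inner_simps)
    have pr: "inner p r = 0" using q(2)[OF p(1)] unfolding r_def by (simp add: inner_commute)
    have 2: "inner (x - p') r = 0"
      using pr unfolding p'_def by (cases "r = 0") (simp_all add: inner_simps)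
    show ?thesis unfolding ceq using 1 2 by (simp add: inner_add_right)
  qed
  with mem show ?case by blast
qed

text \<open>A ball of radius \<open>e\<close> inside \<open>K\<close> would be covered by finitely
  many balls of radius \<open>e\<close>. A vector of norm \<open>e\<close> orthogonal to all
  directions from \<open>x\<close> to their centres leads to a point that none of them
  contains.\<close>

lemma interior_compact_infinite_dim:
  fixes K :: "'a::real_inner set"
  assumes inf_dim: "\<not> (\<exists>B :: 'a set. finite B \<and> span B = UNIV)"
    and "compact K"
  shows "interior K = {}"
proof (rule ccontr)
  assume "interior K \<noteq> {}"
  then obtain x e where e: "e > 0" "cball x e \<subseteq> K"
    by (meson all_not_in_conv interior_subset open_contains_cball open_interior subset_trans)
  have "compact (cball x e)"
    using e \<open>compact K\<close> closed_Int_compact[of "cball x e" K] by (simp add: inf_absorb1)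
  then obtain k where k: "finite k" "cball x e \<subseteq> (\<Union>c\<in>k. ball c e)"
    using e(1) unfolding compact_eq_totally_bounded by meson
  define B where "B = (\<lambda>c. c - x) ` k"
  have "finite B" unfolding B_def using k(1) by simp
  then obtain z where z: "z \<notin> span B" using inf_dim by blast
  obtain p where p: "p \<in> span B" "\<And>b. b \<in> span B \<Longrightarrow> inner (z - p) b = 0"
    using orthogonal_projection_finite_span[OF \<open>finite B\<close>] by blast
  define q where "q = (e / norm (z - p)) *\<^sub>R (z - p)"
  have "z \<noteq> p" using z p(1) by auto
  then have nq: "norm q = e" unfolding q_def using e(1) by simp
  then have "x + q \<in> cball x e" by (simp add: dist_norm)
  then obtain c where c: "c \<in> k" "x + q \<in> ball c e" using k(2) by blast
  have "c - x \<in> span B" using c(1) by (simp add: B_def span_base)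
  then have "inner q (c - x) = 0" unfolding q_def using p(2) by simp
  \<comment> \<open>Pythagoras: moving orthogonally to \<open>c - x\<close> cannot bring
    \<open>x + q\<close> closer to \<open>c\<close> than \<open>e\<close>.\<close>
  then have "(norm (q - (c - x)))\<^sup>2 = e\<^sup>2 + (norm (c - x))\<^sup>2"
    unfolding nq[symmetric] by (simp add: power2_norm_eq_inner inner_diff inner_commute)
  then have "e\<^sup>2 \<le> (norm (q - (c - x)))\<^sup>2" by simp
  then have "e \<le> norm (q - (c - x))" by (rule power2_le_imp_le) simp
  moreover have "norm (q - (c - x)) < e"
    using c(2) by (simp add: dist_norm norm_minus_commute algebra_simps)
  ultimately show False by simp
qed

text \<open>Baire category: each compact piece is closed with empty interior, so the countable union
  has empty interior too.\<close>

lemma interior_sigma_compact_infinite_dim: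
  fixes S :: "'a::{real_inner, complete_space} set"
  assumes inf_dim: "\<not> (\<exists>B :: 'a set. finite B \<and> span B = UNIV)"
    and "sigma_compact S"
  shows "interior S = {}"
proof -
  obtain F where F: "countable F" "\<And>K. K \<in> F \<Longrightarrow> compact K" "\<Union>F = S"
    using assms(2) unfolding sigma_compact_def by blast
  have "euclidean interior_of \<Union>F = {}"
    using F interior_compact_infinite_dim[OF inf_dim]
    by (intro Baire_category_alt) (auto simp: completely_metrizable_space_euclidean compact_imp_closed)
  then show ?thesis using F by simp
qed

lemma sigma_compact_countable_Union:
  assumes "countable G" "\<And>S. S \<in> G \<Longrightarrow> sigma_compact S"
  shows "sigma_compact (\<Union>G)"
proof -
  obtain F where F: "\<And>S. S \<in> G \<Longrightarrow> countable (F S) \<and> (\<forall>K\<in>F S. compact K) \<and> \<Union>(F S) = S"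
    using assms(2) unfolding sigma_compact_def by metis
  have "countable (\<Union>S\<in>G. F S)" using assms(1) F by auto
  moreover have "\<Union>(\<Union>S\<in>G. F S) = (\<Union>S\<in>G. \<Union>(F S))" by blast
  then have "\<Union>(\<Union>S\<in>G. F S) = \<Union>G" using F by simp
  moreover have "\<forall>K\<in>(\<Union>S\<in>G. F S). compact K" using F by auto
  ultimately show ?thesis unfolding sigma_compact_def by blast
qed

lemma sigma_compact_continuous_image:
  assumes "sigma_compact S" "continuous_on S f"
  shows "sigma_compact (f ` S)"
proof -
  obtain F where F: "countable F" "\<And>K. K \<in> F \<Longrightarrow> compact K" "\<Union>F = S"
    using assms(1) unfolding sigma_compact_def by blast
  have "compact (f ` K)" if "K \<in> F" for K
    using F that assms(2) by (meson Union_upper compact_continuous_image continuous_on_subset)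
  moreover have "\<Union>((`) f ` F) = f ` S" using F(3) by auto
  ultimately show ?thesis unfolding sigma_compact_def using F(1)
    by (intro exI[of _ "(`) f ` F"]) auto
qed

text \<open>This is the set of endpoints \<open>c\<close> whose segment from \<open>a\<close> meets
  \<open>S\<close>. Solving \<open>y = a + t (c - a)\<close> for \<open>c\<close> presents it as a
  continuous image of pairs \<open>(t, y)\<close>.\<close>

lemma sigma_compact_segment_directions:
  fixes S :: "'a::real_normed_vector set"
  assumes "sigma_compact S" "a \<notin> S"
  shows "sigma_compact {c. \<exists>t\<in>{0..1}. a + t *\<^sub>R (c - a) \<in> S}"
proof -
  obtain F where F: "countable F" "\<And>K. K \<in> F \<Longrightarrow> compact K" "\<Union>F = S"
    using assms(1) unfolding sigma_compact_def by blast
  \<comment> \<open>Since \<open>a\<close> is not in \<open>S\<close>, the parameter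
    \<open>t\<close> is positive. Cutting \<open>t\<close> off at \<open>1 / (n + 1)\<close> keeps
    the parameter interval compact and \<open>inverse t\<close> continuous.\<close>
  define C where "C = (\<lambda>(n, K). (\<lambda>(t, y). a + inverse t *\<^sub>R (y - a)) ` ({inverse (real (Suc n))..1} \<times> K))"
  have comp: "compact (C (n, K))" if "K \<in> F" for n K
  proof -
    have "0 < inverse (real (Suc n))" by simp
    then have "continuous_on ({inverse (real (Suc n))..1} \<times> K) (\<lambda>(t, y). a + inverse t *\<^sub>R (y - a))"
      unfolding case_prod_unfold by (intro continuous_intros) auto
    then show ?thesis unfolding C_def using F(2)[OF that]
      by (auto intro!: compact_continuous_image compact_Times)
  qed
  have "{c. \<exists>t\<in>{0..1}. a + t *\<^sub>R (c - a) \<in> S} = \<Union>(C ` (UNIV \<times> F))"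
  proof (intro equalityI subsetI)
    fix c assume "c \<in> {c. \<exists>t\<in>{0..1}. a + t *\<^sub>R (c - a) \<in> S}"
    then obtain t where t: "0 \<le> t" "t \<le> 1" "a + t *\<^sub>R (c - a) \<in> S" by auto
    then have "t > 0" using assms(2) by (cases "t = 0") auto
    then obtain n where n: "inverse (real (Suc n)) < t" using reals_Archimedean by blast
    obtain K where K: "K \<in> F" "a + t *\<^sub>R (c - a) \<in> K" using t(3) F(3) by blast
    have "c = a + inverse t *\<^sub>R ((a + t *\<^sub>R (c - a)) - a)" using \<open>t > 0\<close> by simp
    then have "c \<in> C (n, K)"
      unfolding C_def using n K t by (auto intro!: image_eqI[where x = "(t, a + t *\<^sub>R (c - a))"])
    then show "c \<in> \<Union>(C ` (UNIV \<times> F))" using K by blast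
  next
    fix c assume "c \<in> \<Union>(C ` (UNIV \<times> F))"
    then obtain n K t y where *: "K \<in> F" "y \<in> K" "inverse (real (Suc n)) \<le> t" "t \<le> 1"
      "c = a + inverse t *\<^sub>R (y - a)" unfolding C_def by auto
    have "0 < inverse (real (Suc n))" by simp
    then have "t > 0" using *(3) by linarith
    then have "a + t *\<^sub>R (c - a) = y" using * by simp
    then show "c \<in> {c. \<exists>t\<in>{0..1}. a + t *\<^sub>R (c - a) \<in> S}"
      using * F(3) \<open>t > 0\<close> by (auto intro!: bexI[where x = t])
  qed
  moreover have "countable (C ` (UNIV \<times> F))" using F(1) by auto
  ultimately show ?thesis unfolding sigma_compact_def using comp
    by (intro exI[of _ "C ` (UNIV \<times> F)"]) auto
qed

text \<open>The endpoints \<open>c\<close> that are blocked from \<open>a\<close> or from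
  \<open>b\<close> form a \<sigma>-compact set, which cannot be the whole space. An unblocked
  \<open>c\<close> joins \<open>a\<close> to \<open>b\<close> by a broken line avoiding
  \<open>S\<close>.\<close>

lemma connected_Compl_sigma_compact:
  fixes S :: "'a::{real_inner, complete_space} set"
  assumes inf_dim: "\<not> (\<exists>B :: 'a set. finite B \<and> span B = UNIV)"
    and S: "sigma_compact S"
  shows "connected (- S)"
  unfolding connected_iff_connected_component
proof (intro ballI)
  fix a b assume ab: "a \<in> - S" "b \<in> - S"
  let ?D = "\<lambda>a. {c. \<exists>t\<in>{0..1}. a + t *\<^sub>R (c - a) \<in> S}"
  have "sigma_compact (\<Union>{?D a, ?D b})"
    using ab by (intro sigma_compact_countable_Union) (auto intro: sigma_compact_segment_directions[OF S])
  then have "interior (\<Union>{?D a, ?D b}) = {}"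
    by (rule interior_sigma_compact_infinite_dim[OF inf_dim])
  then have "\<Union>{?D a, ?D b} \<noteq> UNIV" by (metis UNIV_not_empty interior_UNIV)
  then obtain c where c: "c \<notin> ?D a" "c \<notin> ?D b" by blast
  have seg: "closed_segment x c \<subseteq> - S" if "c \<notin> ?D x" for x
  proof
    fix y assume "y \<in> closed_segment x c"
    then obtain t where t: "t \<in> {0..1}" "y = (1 - t) *\<^sub>R x + t *\<^sub>R c"
      unfolding closed_segment_def by auto
    then have "y = x + t *\<^sub>R (c - x)" by (simp add: algebra_simps)
    then show "y \<in> - S" using that t(1) by auto
  qed
  have "connected_component (- S) a c" "connected_component (- S) b c"
    unfolding connected_component_def using seg[OF c(1)] seg[OF c(2)]
    by (metis connected_segment(1) ends_in_segment)+
  then show "connected_component (- S) a b"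
    using connected_component_sym connected_component_trans by metis
qed

subsection \<open>Minimizers via the Ekeland principle\<close>

text \<open>\<open>S x\<close> collects the points that pay for their distance from \<open>x\<close>
  by a drop in \<open>F\<close>. Iterating a nearly optimal choice in \<open>S x\<close> produces a
  Cauchy sequence, and no point violates the inequality at its limit.\<close>

lemma ekeland_variational_principle:
  fixes F :: "'a::complete_space \<Rightarrow> real"
  assumes cont: "continuous_on UNIV F" and bdd: "\<And>x. m \<le> F x" and "\<epsilon> > 0"
  shows "\<exists>x. F x \<le> F x0 \<and> (\<forall>y. F x - \<epsilon> * dist x y \<le> F y)"
proof -
  define S where "S = (\<lambda>x. {y. F y + \<epsilon> * dist x y \<le> F x})"
  \<comment> \<open>The chosen \<open>z\<close> covers at least half of the gap between
    \<open>F x\<close> and the infimum of \<open>F\<close> over \<open>S x\<close>; this form avoids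
    naming the infimum.\<close>
  have "\<exists>z\<in>S x. \<forall>y\<in>S x. 2 * F z \<le> F x + F y" for x
  proof -
    have x: "x \<in> S x" unfolding S_def by simp
    have bb: "bdd_below (F ` S x)" using bdd by (intro bdd_belowI2[where m = m]) auto
    define i where "i = Inf (F ` S x)"
    have i: "i \<le> F y" if "y \<in> S x" for y unfolding i_def using bb that by (simp add: cInf_lower)
    show ?thesis
    proof (cases "i = F x")
      case True
      have "2 * F x \<le> F x + F y" if "y \<in> S x" for y using i[OF that] True by simp
      then show ?thesis using x by blast
    next
      case False
      then have "i < (F x + i) / 2" using i[OF x] by simp
      then obtain z where "z \<in> S x" "F z < (F x + i) / 2"
        unfolding i_def using x cInf_lessD[of "F ` S x"] by blast
      moreover have "2 * F z \<le> F x + F y" if "y \<in> S x" for y using i[OF that] calculation(2) by simp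
      ultimately show ?thesis by blast
    qed
  qed
  then obtain g where g: "\<And>x. g x \<in> S x" "\<And>x y. y \<in> S x \<Longrightarrow> 2 * F (g x) \<le> F x + F y"
    by metis
  define u where "u = (\<lambda>n. (g ^^ n) x0)"
  have u0: "u 0 = x0" and uS: "u (Suc n) = g (u n)" for n unfolding u_def by auto
  have trans: "z \<in> S x" if "y \<in> S x" "z \<in> S y" for x y z
  proof -
    have "\<epsilon> * dist x z \<le> \<epsilon> * (dist x y + dist y z)"
      using \<open>\<epsilon> > 0\<close> by (simp add: dist_triangle)
    then show ?thesis using that unfolding S_def by (simp add: algebra_simps)
  qed
  have chain: "u (n + k) \<in> S (u n)" for n k
  proof (induction k)
    case 0
    then show ?case by (simp add: S_def)
  next
    case (Suc k)
    then show ?case using trans[OF _ g(1)] by (simp add: uS)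
  qed
  have step: "F (u k) + \<epsilon> * dist (u n) (u k) \<le> F (u n)" if "n \<le> k" for n k
    using chain[of n "k - n"] that by (simp add: S_def)
  have "decseq (\<lambda>n. F (u n))"
    unfolding decseq_Suc_iff
  proof
    fix n
    have "0 \<le> \<epsilon> * dist (u n) (u (Suc n))" using \<open>\<epsilon> > 0\<close> by simp
    then show "F (u (Suc n)) \<le> F (u n)" using step[of n "Suc n"] by simp
  qed
  then obtain l where l: "(\<lambda>n. F (u n)) \<longlonglongrightarrow> l"
    using decseq_convergent[of "\<lambda>n. F (u n)" m] bdd by blast
  have "Cauchy u"
  proof (rule metric_CauchyI)
    fix e :: real assume "e > 0"
    then have "\<epsilon> * e / 2 > 0" using \<open>\<epsilon> > 0\<close> by simp
    then obtain N where N: "\<And>n k. n \<ge> N \<Longrightarrow> k \<ge> N \<Longrightarrow> dist (F (u n)) (F (u k)) < \<epsilon> * e / 2"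
      using LIMSEQ_imp_Cauchy[OF l] unfolding Cauchy_def by meson
    \<comment> \<open>Distances along the sequence are bounded by drops of \<open>F\<close>, so the
      convergence of \<open>F (u n)\<close> forces \<open>u\<close> to be Cauchy.\<close>
    have "dist (u N) (u k) < e / 2" if "k \<ge> N" for k
    proof -
      have "\<epsilon> * dist (u N) (u k) < \<epsilon> * (e / 2)"
        using step[OF that] N[OF order_refl that] abs_ge_self[of "F (u N) - F (u k)"]
        unfolding dist_real_def by linarith
      then show ?thesis using \<open>\<epsilon> > 0\<close> by (simp only: mult_less_cancel_left_pos)
    qed
    then show "\<exists>N. \<forall>n\<ge>N. \<forall>k\<ge>N. dist (u n) (u k) < e"
      by (metis dist_commute dist_triangle_half_l)
  qed
  then obtain x where x: "u \<longlonglongrightarrow> x" using Cauchy_convergent convergent_def by blast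
  then have Fx: "(\<lambda>n. F (u n)) \<longlonglongrightarrow> F x"
    using cont by (simp add: continuous_on_tendsto_compose)
  have mem: "x \<in> S (u n)" for n
  proof -
    have "(\<lambda>k. F (u k) + \<epsilon> * dist (u n) (u k)) \<longlonglongrightarrow> F x + \<epsilon> * dist (u n) x"
      by (intro tendsto_intros Fx x)
    moreover have "\<forall>\<^sub>F k in sequentially. F (u k) + \<epsilon> * dist (u n) (u k) \<le> F (u n)"
      unfolding eventually_sequentially using step by blast
    ultimately have "F x + \<epsilon> * dist (u n) x \<le> F (u n)"
      by (rule tendsto_upperbound) simp
    then show ?thesis by (simp add: S_def)
  qed
  have "F x - \<epsilon> * dist x y \<le> F y" for y
  proof (rule ccontr)
    assume neg: "\<not> ?thesis"
    then have "y \<in> S x" by (simp add: S_def)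
    \<comment> \<open>A violating \<open>y\<close> was a candidate at every stage. The halving
      property then gives \<open>F x \<le> F y\<close> in the limit, against the violation.\<close>
    then have "y \<in> S (u n)" for n using trans[OF mem] by blast
    then have "2 * F (u (Suc n)) \<le> F (u n) + F y" for n using g(2) uS by simp
    then have "2 * F x \<le> F x + F y"
      by (intro LIMSEQ_le[of "\<lambda>n. 2 * F (u (Suc n))" _ "\<lambda>n. F (u n) + F y"] tendsto_intros Fx LIMSEQ_Suc[OF Fx]) auto
    moreover have "0 \<le> \<epsilon> * dist x y" using \<open>\<epsilon> > 0\<close> by simp
    ultimately show False using neg by linarith
  qed
  moreover have "F x \<le> F x0"
  proof -
    have "0 \<le> \<epsilon> * dist x0 x" using \<open>\<epsilon> > 0\<close> by simp
    then show ?thesis using mem[of 0] by (simp add: S_def u0)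
  qed
  ultimately show ?thesis by blast
qed

lemma has_real_derivative_along_line:
  fixes F :: "'a::real_inner \<Rightarrow> real"
  assumes "\<And>x. (F has_derivative (\<lambda>h. inner (F' x) h)) (at x)"
  shows "((\<lambda>t. F (x + t *\<^sub>R h)) has_real_derivative inner (F' (x + t *\<^sub>R h)) h) (at t)"
proof -
  have "((\<lambda>t. F (x + t *\<^sub>R h)) has_derivative (\<lambda>s. inner (F' (x + t *\<^sub>R h)) (s *\<^sub>R h))) (at t)"
    by (rule has_derivative_compose[OF _ assms]) (auto intro!: derivative_eq_intros)
  moreover have "(\<lambda>s. inner (F' (x + t *\<^sub>R h)) (s *\<^sub>R h)) = (*) (inner (F' (x + t *\<^sub>R h)) h)"
    by (simp add: fun_eq_iff mult.commute)
  ultimately show ?thesis by (simp only: has_field_derivative_def)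
qed

text \<open>Along the direction \<open>- F' x\<close> the functional falls at rate
  \<open>(norm (F' x))\<^sup>2\<close>, while the assumption permits at most
  \<open>\<epsilon> * norm (F' x)\<close>.\<close>

lemma norm_gradient_le_almost_minimizer:
  fixes F :: "'a::real_inner \<Rightarrow> real"
  assumes F': "\<And>x. (F has_derivative (\<lambda>h. inner (F' x) h)) (at x)"
    and "\<epsilon> \<ge> 0" and min: "\<And>y. F x - \<epsilon> * dist x y \<le> F y"
  shows "norm (F' x) \<le> \<epsilon>"
proof (rule ccontr)
  assume neg: "\<not> ?thesis"
  define g where "g = F' x"
  have g: "norm g > \<epsilon>" using neg g_def by simp
  have "((\<lambda>t. F (x + t *\<^sub>R (- g)) + \<epsilon> * norm g * t) has_real_derivative
      inner (F' (x + 0 *\<^sub>R (- g))) (- g) + \<epsilon> * norm g * 1) (at 0)"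
    by (intro DERIV_add DERIV_cmult DERIV_ident has_real_derivative_along_line[OF F'])
  moreover have "inner (F' (x + 0 *\<^sub>R (- g))) (- g) + \<epsilon> * norm g * 1 = - (norm g * (norm g - \<epsilon>))"
    by (simp add: g_def[symmetric] power2_norm_eq_inner[symmetric] power2_eq_square algebra_simps)
  moreover have "0 < norm g * (norm g - \<epsilon>)" using g \<open>\<epsilon> \<ge> 0\<close> by (intro mult_pos_pos) linarith+
  ultimately have "\<exists>d>0. \<forall>h>0. h < d \<longrightarrow>
      F (x + (0 + h) *\<^sub>R (- g)) + \<epsilon> * norm g * (0 + h) < F (x + 0 *\<^sub>R (- g)) + \<epsilon> * norm g * 0"
    by (intro DERIV_neg_dec_right[of _ "- (norm g * (norm g - \<epsilon>))"]) simp_all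
  then obtain d where d: "d > 0"
    "\<And>h. 0 < h \<Longrightarrow> h < d \<Longrightarrow> F (x + h *\<^sub>R (- g)) + \<epsilon> * norm g * h < F x"
    by auto
  have "F (x + (d/2) *\<^sub>R (- g)) + \<epsilon> * norm g * (d/2) < F x"
    using d(2)[of "d/2"] d(1) by simp
  moreover have "F x - \<epsilon> * (norm g * (d/2)) \<le> F (x + (d/2) *\<^sub>R (- g))"
    using min[of "x + (d/2) *\<^sub>R (- g)"] d(1) by (simp add: dist_norm mult.commute)
  ultimately show False by (simp add: mult.assoc)
qed

text \<open>Ekeland's principle upgrades a minimizing sequence to one whose gradients tend to zero.
  The Palais-Smale hypothesis \<open>PS\<close> gives a convergent subsequence, and by continuity
  its limit is a minimizer.\<close>

lemma palais_smale_minimizer: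
  fixes F :: "'a::{real_inner, complete_space} \<Rightarrow> real"
  assumes F': "\<And>x. (F has_derivative (\<lambda>h. inner (F' x) h)) (at x)"
    and bdd: "\<And>x. m \<le> F x"
    and PS: "\<And>u C. (\<And>n. F (u n) \<le> C) \<Longrightarrow> (\<lambda>n. F' (u n)) \<longlonglongrightarrow> 0 \<Longrightarrow>
      \<exists>l r. strict_mono (r :: nat \<Rightarrow> nat) \<and> (u \<circ> r) \<longlonglongrightarrow> l"
  shows "\<exists>x. \<forall>y. F x \<le> F y"
proof -
  have contF: "continuous_on UNIV F"
    using F' has_derivative_continuous by (fastforce intro: continuous_at_imp_continuous_on)
  have bb: "bdd_below (range F)" using bdd by (intro bdd_belowI2) auto
  define i where "i = Inf (range F)"
  have i: "i \<le> F y" for y unfolding i_def using bb by (simp add: cInf_lower)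
  have "\<exists>x. F x < i + inverse (real (Suc n)) \<and> norm (F' x) \<le> inverse (real (Suc n))" for n
  proof -
    have "i < i + inverse (real (Suc n))" by simp
    then obtain x0 where x0: "F x0 < i + inverse (real (Suc n))"
      unfolding i_def using cInf_lessD[of "range F"] by blast
    have "0 < inverse (real (Suc n))" by simp
    then obtain x where x: "F x \<le> F x0" "\<And>y. F x - inverse (real (Suc n)) * dist x y \<le> F y"
      using ekeland_variational_principle[OF contF bdd, of "inverse (real (Suc n))" x0] by blast
    have "norm (F' x) \<le> inverse (real (Suc n))"
      by (rule norm_gradient_le_almost_minimizer[OF F' _ x(2)]) simp
    then show ?thesis using x(1) x0 by (meson le_less_trans)
  qed
  then obtain u where u: "\<And>n. F (u n) < i + inverse (real (Suc n))"
    "\<And>n. norm (F' (u n)) \<le> inverse (real (Suc n))" by metis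
  have "F (u n) \<le> i + 1" for n
  proof -
    have "inverse (real (Suc n)) \<le> 1" by (simp add: field_simps)
    then show ?thesis using u(1)[of n] by linarith
  qed
  moreover have "(\<lambda>n. F' (u n)) \<longlonglongrightarrow> 0"
    by (rule Lim_null_comparison[OF _ LIMSEQ_inverse_real_of_nat]) (use u(2) in auto)
  ultimately obtain l r where r: "strict_mono (r :: nat \<Rightarrow> nat)" "(u \<circ> r) \<longlonglongrightarrow> l"
    using PS[of u "i + 1"] by blast
  have "(\<lambda>n. F ((u \<circ> r) n)) \<longlonglongrightarrow> F l"
    using contF r(2) by (rule continuous_on_tendsto_compose) auto
  moreover have "(\<lambda>n. i + inverse (real (Suc (r n)))) \<longlonglongrightarrow> i + 0"
    using LIMSEQ_subseq_LIMSEQ[OF LIMSEQ_inverse_real_of_nat r(1)]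
    by (intro tendsto_intros) (simp add: o_def)
  ultimately have "F l \<le> i + 0"
    proof (rule LIMSEQ_le)
    show "\<exists>N. \<forall>n\<ge>N. F ((u \<circ> r) n) \<le> i + inverse (real (Suc (r n)))"
      using less_imp_le[OF u(1)] by (metis comp_apply)
  qed
  then have "F l \<le> F y" for y using i[of y] by simp
  then show ?thesis by blast
qed

subsection \<open>Second derivatives and compactness\<close>

text \<open>If the form were negative at \<open>y\<close>, the slope of \<open>F\<close> along
  \<open>y\<close> would vanish at \<open>x\<close> and be negative just after it; the mean value
  theorem would then give a value below the minimum.\<close>

lemma second_order_necessary_condition:
  fixes F :: "'a::real_inner \<Rightarrow> real"
  assumes F': "\<And>x. (F has_derivative (\<lambda>h. inner (F' x) h)) (at x)"
    and A: "(F' has_derivative A) (at x)" and min: "\<And>y. F x \<le> F y"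
  shows "F' x = 0" "inner (A y) y \<ge> 0"
proof -
  show crit: "F' x = 0"
    using norm_gradient_le_almost_minimizer[OF F', of 0 x] min by simp
  show "inner (A y) y \<ge> 0"
  proof (rule ccontr)
    assume neg: "\<not> inner (A y) y \<ge> 0"
    have "(F' has_derivative A) (at (x + 0 *\<^sub>R y))" using A by simp
    then have "((\<lambda>t. F' (x + t *\<^sub>R y)) has_derivative (\<lambda>s. A (s *\<^sub>R y))) (at 0)"
      by (rule has_derivative_compose[rotated]) (auto intro!: derivative_eq_intros)
    then have "((\<lambda>t. inner (F' (x + t *\<^sub>R y)) y) has_derivative (\<lambda>s. inner (A (s *\<^sub>R y)) y)) (at 0)"
      by (rule has_derivative_inner_left)
    moreover have "(\<lambda>s. inner (A (s *\<^sub>R y)) y) = (*) (inner (A y) y)"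
      using A by (simp add: fun_eq_iff has_derivative_bounded_linear linear_scale bounded_linear.linear mult.commute)
    ultimately have "((\<lambda>t. inner (F' (x + t *\<^sub>R y)) y) has_real_derivative inner (A y) y) (at 0)"
      by (simp only: has_field_derivative_def)
    from DERIV_neg_dec_right[OF this] neg[unfolded not_le]
    have "\<exists>d>0. \<forall>h>0. h < d \<longrightarrow> inner (F' (x + (0 + h) *\<^sub>R y)) y < inner (F' (x + 0 *\<^sub>R y)) y"
      by blast
    then obtain d where d: "d > 0" "\<And>h. 0 < h \<Longrightarrow> h < d \<Longrightarrow> inner (F' (x + h *\<^sub>R y)) y < 0"
      using crit by auto
    have "0 < d / 2" using d(1) by simp
    from MVT2[OF this has_real_derivative_along_line[OF F', where x = x and h = y]]
    obtain z where z: "0 < z" "z < d / 2"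
      "F (x + (d/2) *\<^sub>R y) - F (x + 0 *\<^sub>R y) = (d/2 - 0) * inner (F' (x + z *\<^sub>R y)) y"
      by blast
    have "(d/2) * inner (F' (x + z *\<^sub>R y)) y < 0"
      using d z by (intro mult_pos_neg) auto
    then show False using z(3) min[of "x + (d/2) *\<^sub>R y"] by simp
  qed
qed

text \<open>The mean value theorem in direction \<open>u\<close> turns the second difference into
  \<open>t\<close> times a difference of gradients. Expanding \<open>F'\<close> to first order about
  \<open>x\<close> at both points leaves \<open>t *\<^sub>R A v\<close> plus a small error.\<close>

lemma second_difference_quotient_tendsto:
  fixes F :: "'a::real_inner \<Rightarrow> real"
  assumes F': "\<And>x. (F has_derivative (\<lambda>h. inner (F' x) h)) (at x)"
    and A: "(F' has_derivative A) (at x)"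
  shows "((\<lambda>t. (F (x + t *\<^sub>R v + t *\<^sub>R u) - F (x + t *\<^sub>R u) - F (x + t *\<^sub>R v) + F x) / t\<^sup>2)
    \<longlongrightarrow> inner (A v) u) (at_right 0)"
proof (rule tendstoI)
  fix e :: real assume "e > 0"
  define K where "K = norm u + norm v + 1"
  have K: "K > 0" "norm u \<le> K" "norm v \<le> K" unfolding K_def by (auto intro: add_nonneg_pos)
  \<comment> \<open>Two expansion errors of size \<open>e' * (t * K)\<close>, paired with a vector
    of norm at most \<open>K\<close> and divided by \<open>t\<close>, add up to
    \<open>2 * e' * K\<^sup>2 = e / 2\<close>.\<close>
  define e' where "e' = e / (4 * K\<^sup>2)"
  have e': "e' > 0" unfolding e'_def using \<open>e > 0\<close> K by simp
  obtain d where d: "d > 0" "\<And>y. norm (y - x) < d \<Longrightarrow> norm (F' y - F' x - A (y - x)) \<le> e' * norm (y - x)"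
    using A e' unfolding has_derivative_at_alt by blast
  have lin: "linear A" using A by (simp add: has_derivative_bounded_linear bounded_linear.linear)
  have bound: "\<bar>(F (x + t *\<^sub>R v + t *\<^sub>R u) - F (x + t *\<^sub>R u) - F (x + t *\<^sub>R v) + F x) / t\<^sup>2 - inner (A v) u\<bar> < e"
    if t: "0 < t" "t < d / K" for t
  proof -
    have "((\<lambda>s. F (x + t *\<^sub>R v + s *\<^sub>R u) - F (x + s *\<^sub>R u)) has_real_derivative
        inner (F' (x + t *\<^sub>R v + s *\<^sub>R u)) u - inner (F' (x + s *\<^sub>R u)) u) (at s)" for s
      by (intro DERIV_diff has_real_derivative_along_line[OF F'])
    from MVT2[OF t(1) this]
    obtain s where s: "0 < s" "s < t"
      "(F (x + t *\<^sub>R v + t *\<^sub>R u) - F (x + t *\<^sub>R u)) - (F (x + t *\<^sub>R v + 0 *\<^sub>R u) - F (x + 0 *\<^sub>R u))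
        = (t - 0) * (inner (F' (x + t *\<^sub>R v + s *\<^sub>R u)) u - inner (F' (x + s *\<^sub>R u)) u)"
      by blast
    define z1 z2 where "z1 = t *\<^sub>R v + s *\<^sub>R u" and "z2 = s *\<^sub>R u"
    have "norm z1 \<le> t * norm v + s * norm u" unfolding z1_def using s t
      by (metis abs_of_pos norm_scaleR norm_triangle_ineq)
    also have "\<dots> \<le> t * norm v + t * norm u" using s by (simp add: mult_right_mono)
    also have "\<dots> < t * K" using t unfolding K_def by (simp add: algebra_simps)
    finally have z1: "norm z1 \<le> t * K" by simp
    have z2: "norm z2 \<le> t * K" unfolding z2_def using s K by (simp add: mult_mono)
    have tK: "t * K < d" using t K by (simp add: field_simps)
    have r1: "norm (F' (x + z1) - F' x - A z1) \<le> e' * (t * K)"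
      using d(2)[of "x + z1"] z1 tK e' by (simp add: order_trans[OF _ mult_left_mono])
    have r2: "norm (F' (x + z2) - F' x - A z2) \<le> e' * (t * K)"
      using d(2)[of "x + z2"] z2 tK e' by (simp add: order_trans[OF _ mult_left_mono])
    have "z1 - z2 = t *\<^sub>R v" by (simp add: z1_def z2_def)
    then have "A z1 - A z2 = t *\<^sub>R A v" by (metis lin linear_diff linear_scale)
    then have "F' (x + z1) - F' (x + z2) - t *\<^sub>R A v
        = (F' (x + z1) - F' x - A z1) - (F' (x + z2) - F' x - A z2)" by (simp add: algebra_simps)
    then have "norm (F' (x + z1) - F' (x + z2) - t *\<^sub>R A v) \<le> e' * (t * K) + e' * (t * K)"
      using order_trans[OF norm_triangle_ineq4 add_mono[OF r1 r2]] by (simp only:)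
    then have "norm (F' (x + z1) - F' (x + z2) - t *\<^sub>R A v) * norm u \<le> (e' * (t * K) + e' * (t * K)) * K"
      using K e' t by (intro mult_mono) auto
    from order_trans[OF Cauchy_Schwarz_ineq2 this]
    have est: "\<bar>inner (F' (x + z1) - F' (x + z2) - t *\<^sub>R A v) u\<bar> \<le> 2 * e' * t * K\<^sup>2"
      by (simp add: power2_eq_square algebra_simps)
    have "F (x + t *\<^sub>R v + t *\<^sub>R u) - F (x + t *\<^sub>R u) - F (x + t *\<^sub>R v) + F x
        = t * inner (F' (x + z1) - F' (x + z2)) u"
      using s(3) by (simp add: z1_def z2_def inner_diff_left add.assoc)
    moreover have "inner (F' (x + z1) - F' (x + z2) - t *\<^sub>R A v) u
        = inner (F' (x + z1) - F' (x + z2)) u - t * inner (A v) u"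
      by (simp add: inner_diff_left)
    moreover have "t * X / t\<^sup>2 - Y = (X - t * Y) / t" for X Y :: real
      using t by (simp add: power2_eq_square diff_divide_distrib)
    ultimately have "(F (x + t *\<^sub>R v + t *\<^sub>R u) - F (x + t *\<^sub>R u) - F (x + t *\<^sub>R v) + F x) / t\<^sup>2 - inner (A v) u
        = inner (F' (x + z1) - F' (x + z2) - t *\<^sub>R A v) u / t"
      by (simp only:)
    also have "\<bar>\<dots>\<bar> \<le> 2 * e' * K\<^sup>2"
      using est t by (simp add: pos_divide_le_eq mult.assoc mult.commute[of t])
    also have "\<dots> < e" unfolding e'_def using K \<open>e > 0\<close> by simp
    finally show ?thesis .
  qed
  have "d / K > 0" using d K by simp
  then show "\<forall>\<^sub>F t in at_right 0.
      dist ((F (x + t *\<^sub>R v + t *\<^sub>R u) - F (x + t *\<^sub>R u) - F (x + t *\<^sub>R v) + F x) / t\<^sup>2) (inner (A v) u) < e"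
    unfolding eventually_at_right_field dist_real_def using bound by blast
qed

text \<open>The second difference is unchanged when \<open>u\<close> and \<open>v\<close> are
  exchanged, so its two limits agree.\<close>

lemma second_derivative_symmetric:
  fixes F :: "'a::real_inner \<Rightarrow> real"
  assumes F': "\<And>x. (F has_derivative (\<lambda>h. inner (F' x) h)) (at x)"
    and A: "(F' has_derivative A) (at x)"
  shows "inner (A u) v = inner (A v) u"
proof -
  have swap: "F (x + t *\<^sub>R u + t *\<^sub>R v) - F (x + t *\<^sub>R v) - F (x + t *\<^sub>R u)
      = F (x + t *\<^sub>R v + t *\<^sub>R u) - F (x + t *\<^sub>R u) - F (x + t *\<^sub>R v)" for t
    by (simp add: add.commute add.left_commute)
  have "((\<lambda>t. (F (x + t *\<^sub>R v + t *\<^sub>R u) - F (x + t *\<^sub>R u) - F (x + t *\<^sub>R v) + F x) / t\<^sup>2)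
      \<longlongrightarrow> inner (A u) v) (at_right 0)"
    using second_difference_quotient_tendsto[OF F' A, of u v] unfolding swap .
  then show ?thesis
    using second_difference_quotient_tendsto[OF F' A, of v u]
    by (rule tendsto_unique[OF trivial_limit_at_right_real])
qed

section \<open>Compact linear operators and coercivity\<close>

text \<open>On the unit ball, \<open>A y\<close> is uniformly close to
  \<open>(f (x + r y) - f x) / r\<close>. A finite net for the image of a small ball under
  \<open>f\<close>, translated and rescaled, is therefore a net for the image under
  \<open>A\<close>.\<close>

lemma compact_derivative_of_compact_map:
  fixes f :: "'a::real_normed_vector \<Rightarrow> 'b::{real_normed_vector, complete_space}"
  assumes f: "compact_map f" and A: "(f has_derivative A) (at x)"
  shows "compact (closure (A ` cball 0 1))"
  unfolding compact_eq_totally_bounded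
proof (intro conjI allI impI)
  show "complete (closure (A ` cball 0 1))" by (simp add: complete_eq_closed)
  fix e :: real assume "e > 0"
  then have "e / 4 > 0" by simp
  then obtain d where d: "d > 0" "\<And>y. norm (y - x) < d \<Longrightarrow> norm (f y - f x - A (y - x)) \<le> e / 4 * norm (y - x)"
    using A unfolding has_derivative_at_alt by blast
  define r where "r = d / 2"
  have r: "r > 0" "r < d" using d(1) by (auto simp: r_def)
  have lin: "linear A" using A by (simp add: has_derivative_bounded_linear bounded_linear.linear)
  have "compact (closure (f ` cball x r))" using f unfolding compact_map_def by simp
  then obtain k where k: "finite k" "closure (f ` cball x r) \<subseteq> (\<Union>c\<in>k. ball c (r * e / 4))"
    unfolding compact_eq_totally_bounded using \<open>e > 0\<close> r(1)
    by (metis divide_pos_pos mult_pos_pos zero_less_numeral)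
  define k' where "k' = (\<lambda>c. (c - f x) /\<^sub>R r) ` k"
  have "A ` cball 0 1 \<subseteq> (\<Union>c\<in>k'. cball c (e / 2))"
  proof
    fix w assume "w \<in> A ` cball 0 1"
    then obtain y where y: "w = A y" "norm y \<le> 1" by auto
    have n: "norm (r *\<^sub>R y) \<le> r" using y r by (simp add: mult_left_le)
    then have "f (x + r *\<^sub>R y) \<in> closure (f ` cball x r)"
      by (intro subsetD[OF closure_subset] imageI) (simp add: dist_norm)
    then obtain c where c: "c \<in> k" "norm (c - f (x + r *\<^sub>R y)) < r * e / 4"
      using k(2) by (auto simp: dist_norm)
    have "norm (f (x + r *\<^sub>R y) - f x - A (r *\<^sub>R y)) \<le> e / 4 * norm (r *\<^sub>R y)"
      using d(2)[of "x + r *\<^sub>R y"] n r by (simp del: norm_scaleR)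
    also have "\<dots> \<le> e / 4 * r" using n \<open>e > 0\<close> by (intro mult_left_mono) auto
    \<comment> \<open>The net and the linearization each contribute \<open>r * e / 4\<close>;
      division by \<open>r\<close> leaves the radius \<open>e / 2\<close>.\<close>
    finally have "norm ((c - f (x + r *\<^sub>R y)) + (f (x + r *\<^sub>R y) - f x - A (r *\<^sub>R y))) \<le> r * (e / 2)"
      using c(2) norm_triangle_ineq[of "c - f (x + r *\<^sub>R y)" "f (x + r *\<^sub>R y) - f x - A (r *\<^sub>R y)"]
      by (simp add: algebra_simps)
    moreover have "(c - f (x + r *\<^sub>R y)) + (f (x + r *\<^sub>R y) - f x - A (r *\<^sub>R y)) = r *\<^sub>R ((c - f x) /\<^sub>R r - w)"
      using r by (simp add: y(1) linear_scale[OF lin] scaleR_diff_right)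
    ultimately have "r * norm ((c - f x) /\<^sub>R r - w) \<le> r * (e / 2)" using r by simp
    then have "norm ((c - f x) /\<^sub>R r - w) \<le> e / 2" using r(1) mult_le_cancel_left_pos by blast
    then show "w \<in> (\<Union>c\<in>k'. cball c (e / 2))"
      unfolding k'_def using c(1) by (auto simp: dist_norm)
  qed
  \<comment> \<open>Closed balls of radius \<open>e / 2\<close> let the inclusion pass to the
    closure; the slack up to \<open>e\<close> restores open balls.\<close>
  moreover have "closed (\<Union>c\<in>k'. cball c (e / 2))" using k(1) unfolding k'_def by (intro closed_UN) auto
  ultimately have "closure (A ` cball 0 1) \<subseteq> (\<Union>c\<in>k'. cball c (e / 2))" by (simp add: closure_minimal)
  also have "\<dots> \<subseteq> (\<Union>c\<in>k'. ball c e)" using \<open>e > 0\<close> by force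
  finally show "\<exists>k. finite k \<and> closure (A ` cball 0 1) \<subseteq> (\<Union>c\<in>k. ball c e)"
    using k(1) k'_def by blast
qed

text \<open>By compactness \<open>T (u n)\<close> converges along a subsequence, and
  \<open>u n\<close> must follow it to the same limit. That limit has norm 1 and is fixed by
  continuity.\<close>

lemma fixed_vector_of_approximate_fixed_vectors:
  fixes T :: "'a::real_normed_vector \<Rightarrow> 'a"
  assumes T: "bounded_linear T" "compact (closure (T ` cball 0 1))"
    and u: "\<And>n::nat. norm (u n) = 1" "(\<lambda>n. u n - T (u n)) \<longlonglongrightarrow> 0"
  shows "\<exists>y. y \<noteq> 0 \<and> y = T y"
proof -
  have "\<forall>n. T (u n) \<in> closure (T ` cball 0 1)"
    using u(1) by (auto intro!: subsetD[OF closure_subset] imageI)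
  then obtain y r where r: "strict_mono (r :: nat \<Rightarrow> nat)" "((\<lambda>n. T (u n)) \<circ> r) \<longlonglongrightarrow> y"
    using T(2) unfolding compact_def by meson
  have "(\<lambda>n. (u (r n) - T (u (r n))) + T (u (r n))) \<longlonglongrightarrow> 0 + y"
    using LIMSEQ_subseq_LIMSEQ[OF u(2) r(1)] r(2) by (intro tendsto_add) (simp_all add: o_def)
  then have ur: "(\<lambda>n. u (r n)) \<longlonglongrightarrow> y" by simp
  have "(\<lambda>n. T (u (r n))) \<longlonglongrightarrow> T y" by (rule bounded_linear.tendsto[OF T(1) ur])
  then have "y = T y" using r(2) LIMSEQ_unique by (fastforce simp: o_def)
  moreover have "norm y = 1" using tendsto_norm[OF ur] u(1) by (simp add: LIMSEQ_const_iff)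
  ultimately show ?thesis by (metis norm_zero zero_neq_one)
qed

text \<open>Without coercivity there are unit vectors on which the form tends to zero.
  Semidefiniteness makes them approximate fixed vectors of \<open>T\<close>, and compactness then
  yields a nonzero fixed vector.\<close>

lemma coercive_of_nonneg_injective:
  fixes T :: "'a::real_inner \<Rightarrow> 'a"
  assumes T: "bounded_linear T" "compact (closure (T ` cball 0 1))"
    and sym: "\<And>u v. inner (T u) v = inner (T v) u"
    and nonneg: "\<And>y. inner (y - T y) y \<ge> 0"
    and inj: "\<And>y. y = T y \<Longrightarrow> y = 0"
  shows "\<exists>c>0. \<forall>y. c * (norm y)\<^sup>2 \<le> inner (y - T y) y"
proof (rule ccontr)
  assume neg: "\<not> ?thesis"
  have lin: "linear T" using T(1) by (rule bounded_linear.linear)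
  have "bounded_linear (\<lambda>y. y - T y)" by (intro bounded_linear_intros T)
  then obtain K where K: "K > 0" "\<And>y. norm (y - T y) \<le> norm y * K"
    using bounded_linear.pos_bounded by blast
  \<comment> \<open>Cauchy-Schwarz for the semidefinite form of \<open>I - T\<close>\<close>
  have CS: "(norm (y - T y))\<^sup>2 \<le> K * inner (y - T y) y" for y
  proof -
    define w where "w = y - T y"
    define t where "t = inverse K"
    have "inner (w - T w) w \<le> norm (w - T w) * norm w" by (rule norm_cauchy_schwarz)
    also have "\<dots> \<le> norm w * K * norm w" using K(2)[of w] by (intro mult_right_mono) auto
    finally have "inner (w - T w) w \<le> K * inner w w"
      by (simp add: power2_norm_eq_inner[symmetric] power2_eq_square algebra_simps)
    then have "t\<^sup>2 * inner (w - T w) w \<le> t\<^sup>2 * (K * inner w w)" by (intro mult_left_mono) auto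
    also have "\<dots> = t * inner w w" unfolding t_def using K by (simp add: power2_eq_square)
    finally have 1: "t\<^sup>2 * inner (w - T w) w \<le> t * inner w w" .
    have 2: "inner (w - T w) y = inner w w"
      using sym[of w y] unfolding w_def
      by (simp add: inner_diff_left inner_diff_right inner_commute)
    \<comment> \<open>Nonnegativity is tested at \<open>y - t w\<close>. With
      \<open>t = 1 / K\<close>, the quadratic term is at most \<open>t * inner w w\<close>, half of
      what the cross term subtracts.\<close>
    have "0 \<le> inner ((y - t *\<^sub>R w) - T (y - t *\<^sub>R w)) (y - t *\<^sub>R w)" by (rule nonneg)
    also have "(y - t *\<^sub>R w) - T (y - t *\<^sub>R w) = w - t *\<^sub>R (w - T w)"
      by (simp add: linear_diff[OF lin] linear_scale[OF lin] w_def scaleR_diff_right)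
    also have "inner \<dots> (y - t *\<^sub>R w) = inner w y - 2 * t * inner w w + t\<^sup>2 * inner (w - T w) w"
      unfolding inner_diff_right inner_diff_left[of w "t *\<^sub>R (w - T w)"] inner_scaleR_left inner_scaleR_right 2
      by (simp add: power2_eq_square algebra_simps)
    finally have "t * inner w w \<le> inner w y" using 1 by linarith
    then show ?thesis unfolding t_def w_def[symmetric] power2_norm_eq_inner using K(1) by (simp add: field_simps)
  qed
  have "\<exists>y. norm y = 1 \<and> inner (y - T y) y \<le> inverse (real (Suc n))" for n
  proof -
    have "0 < inverse (real (Suc n))" by simp
    then obtain y where y: "inner (y - T y) y < inverse (real (Suc n)) * (norm y)\<^sup>2"
      using neg by (meson not_le)
    then have ny: "norm y > 0" using nonneg[of y] by (cases "y = 0") auto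
    define z where "z = y /\<^sub>R norm y"
    have "z - T z = (y - T y) /\<^sub>R norm y" by (simp add: z_def linear_scale[OF lin] scaleR_diff_right)
    then have "inner (z - T z) z = inner (y - T y) y / (norm y)\<^sup>2"
      by (simp add: z_def power2_eq_square divide_simps)
    also have "\<dots> \<le> inverse (real (Suc n))" using y ny by (simp add: pos_divide_le_eq)
    finally show ?thesis using ny by (intro exI[of _ z]) (simp add: z_def)
  qed
  then obtain u where u: "\<And>n. norm (u n) = 1" "\<And>n. inner (u n - T (u n)) (u n) \<le> inverse (real (Suc n))"
    by metis
  have "(\<lambda>n. (norm (u n - T (u n)))\<^sup>2) \<longlonglongrightarrow> 0"
  proof (rule Lim_null_comparison)
    show "(\<lambda>n. K * inverse (real (Suc n))) \<longlonglongrightarrow> 0"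
      using tendsto_mult_left[OF LIMSEQ_inverse_real_of_nat, of K] by simp
    show "\<forall>\<^sub>F n in sequentially. norm ((norm (u n - T (u n)))\<^sup>2) \<le> K * inverse (real (Suc n))"
      using order_trans[OF CS mult_left_mono[OF u(2)]] K(1) by (simp add: always_eventually del: of_nat_Suc)
  qed
  then have "(\<lambda>n. sqrt ((norm (u n - T (u n)))\<^sup>2)) \<longlonglongrightarrow> sqrt 0" by (rule tendsto_real_sqrt)
  then have "(\<lambda>n. u n - T (u n)) \<longlonglongrightarrow> 0" by (simp add: tendsto_norm_zero_iff)
  from fixed_vector_of_approximate_fixed_vectors[OF T u(1) this]
  obtain y where y: "y \<noteq> 0" "y = T y" by blast
  show False using inj[OF y(2)] y(1) by contradiction
qed

subsection \<open>The singular set\<close>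

lemma tilted_quadratic_has_gradient:
  fixes G :: "'a::real_inner \<Rightarrow> real"
  assumes "(G has_derivative (\<lambda>h. inner (g x) h)) (at x)"
  shows "((\<lambda>x. inner x x / 2 - G x - inner v x) has_derivative (\<lambda>h. inner (x - g x - v) h)) (at x)"
proof -
  have "((\<lambda>x. inner x x) has_derivative (\<lambda>h. inner x h + inner h x)) (at x)"
    by (rule has_derivative_inner[OF has_derivative_ident has_derivative_ident])
  then have "((\<lambda>x. inner x x / 2) has_derivative (\<lambda>h. (inner x h + inner h x) / 2)) (at x)"
    by (rule bounded_linear.has_derivative[OF bounded_linear_divide])
  then have "((\<lambda>x. inner x x / 2 - G x - inner v x) has_derivative
      (\<lambda>h. (inner x h + inner h x) / 2 - inner (g x) h - inner v h)) (at x)"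
    by (intro has_derivative_diff assms has_derivative_inner_right has_derivative_ident)
  moreover have "(inner x h + inner h x) / 2 - inner (g x) h - inner v h = inner (x - g x - v) h" for h
    by (simp add: inner_diff_left inner_commute[of h])
  ultimately show ?thesis by (simp only:)
qed

text \<open>Growth with \<open>m < 1\<close> gives a coercive lower bound, so Palais-Smale sequences
  are bounded. Compactness makes \<open>g (u n)\<close> converge along a subsequence, and
  \<open>u n\<close> differs from \<open>g (u n) + v\<close> by a null sequence.\<close>

lemma tilted_quadratic_has_minimizer:
  fixes G :: "'a::{real_inner, complete_space} \<Rightarrow> real"
  assumes G1: "\<And>x. (G has_derivative (\<lambda>h. inner (g x) h)) (at x)"
    and cg: "compact_map g"
    and growth: "m < 1" "\<And>x. G x \<le> D + m / 2 * (norm x)\<^sup>2"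
  shows "\<exists>x. \<forall>y. inner x x / 2 - G x - inner v x \<le> inner y y / 2 - G y - inner v y"
proof -
  \<comment> \<open>The quadratic part exceeds its growth bound by
    \<open>a * (norm x)\<^sup>2\<close>; half of this absorbs the linear term through Young's
    inequality.\<close>
  define a where "a = (1 - m) / 2"
  have a: "a > 0" using growth(1) by (simp add: a_def)
  define E where "E = (norm v)\<^sup>2 / (2 * a) + D"
  have lower: "a / 2 * (norm x)\<^sup>2 - E \<le> inner x x / 2 - G x - inner v x" for x
  proof -
    have "0 \<le> (a * norm x - norm v)\<^sup>2 / (2 * a)" using a by simp
    also have "\<dots> = a / 2 * (norm x)\<^sup>2 - norm v * norm x + (norm v)\<^sup>2 / (2 * a)"
      using a by (simp add: power2_eq_square field_simps)
    finally have "norm v * norm x \<le> a / 2 * (norm x)\<^sup>2 + (norm v)\<^sup>2 / (2 * a)" by simp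
    then have "inner v x \<le> a / 2 * (norm x)\<^sup>2 + (norm v)\<^sup>2 / (2 * a)"
      using norm_cauchy_schwarz[of v x] by linarith
    moreover have "inner x x / 2 - m / 2 * (norm x)\<^sup>2 = a * (norm x)\<^sup>2"
      by (simp add: a_def power2_norm_eq_inner field_simps)
    moreover have "a * (norm x)\<^sup>2 = a / 2 * (norm x)\<^sup>2 + a / 2 * (norm x)\<^sup>2" by simp
    ultimately show ?thesis using growth(2)[of x] unfolding E_def by linarith
  qed
  show ?thesis
  proof (rule palais_smale_minimizer)
    show "((\<lambda>x. inner x x / 2 - G x - inner v x) has_derivative (\<lambda>h. inner (x - g x - v) h)) (at x)" for x
      by (rule tilted_quadratic_has_gradient[OF G1])
    show "- E \<le> inner x x / 2 - G x - inner v x" for x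
    proof -
      have "0 \<le> a / 2 * (norm x)\<^sup>2" using a by simp
      then show ?thesis using lower[of x] by linarith
    qed
    fix u :: "nat \<Rightarrow> 'a" and C
    assume C: "\<And>n. inner (u n) (u n) / 2 - G (u n) - inner v (u n) \<le> C"
      and lim: "(\<lambda>n. u n - g (u n) - v) \<longlonglongrightarrow> 0"
    have "norm (u n) \<le> sqrt ((C + E) / (a / 2))" for n
    proof -
      have "a / 2 * (norm (u n))\<^sup>2 \<le> C + E" using lower[of "u n"] C[of n] by linarith
      then have "(norm (u n))\<^sup>2 \<le> (C + E) / (a / 2)" using a by (simp add: field_simps)
      then show ?thesis by (rule real_le_rsqrt)
    qed
    then have "bounded (range u)" unfolding bounded_iff by blast
    then have "compact (closure (g ` range u))" using cg unfolding compact_map_def by blast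
    moreover have "\<forall>n. g (u n) \<in> closure (g ` range u)"
      by (auto intro: subsetD[OF closure_subset])
    ultimately obtain w r where r: "strict_mono (r :: nat \<Rightarrow> nat)" "((\<lambda>n. g (u n)) \<circ> r) \<longlonglongrightarrow> w"
      unfolding compact_def by meson
    have "(\<lambda>n. (u (r n) - g (u (r n)) - v) + g (u (r n)) + v) \<longlonglongrightarrow> 0 + w + v"
      using LIMSEQ_subseq_LIMSEQ[OF lim r(1)] r(2) by (intro tendsto_add tendsto_const) (simp_all add: o_def)
    then have "(u \<circ> r) \<longlonglongrightarrow> w + v" by (simp add: o_def)
    then show "\<exists>l r. strict_mono (r :: nat \<Rightarrow> nat) \<and> (u \<circ> r) \<longlonglongrightarrow> l" using r(1) by blast
  qed
qed

text \<open>Unit fixed vectors of \<open>H (x n)\<close> are approximately fixed by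
  \<open>H l\<close>, because \<open>H (x n)\<close> tends to \<open>H l\<close> in operator
  norm.\<close>

lemma closed_fixed_vector_parameters:
  fixes H :: "'b::metric_space \<Rightarrow> ('a::real_normed_vector \<Rightarrow>\<^sub>L 'a)"
  assumes cont: "continuous_on UNIV H" and comp: "\<And>x. compact (closure (H x ` cball 0 1))"
  shows "closed {x. \<exists>y. y \<noteq> 0 \<and> y = H x y}"
  unfolding closed_sequential_limits
proof (intro allI impI, elim conjE)
  fix x l assume mem: "\<forall>n. x n \<in> {x. \<exists>y. y \<noteq> 0 \<and> y = H x y}" and lim: "x \<longlonglongrightarrow> l"
  have "\<exists>y. norm y = 1 \<and> y = H (x n) y" for n
  proof -
    obtain y where y: "y \<noteq> 0" "y = H (x n) y" using mem by blast
    have "H (x n) (y /\<^sub>R norm y) = y /\<^sub>R norm y" by (simp only: blinfun.scaleR_right y(2)[symmetric])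
    then show ?thesis using y(1) by (intro exI[of _ "y /\<^sub>R norm y"]) simp
  qed
  then obtain u where u: "\<And>n. norm (u n) = 1" "\<And>n. u n = H (x n) (u n)" by metis
  have "(\<lambda>n. H (x n)) \<longlonglongrightarrow> H l" using cont lim by (rule continuous_on_tendsto_compose) auto
  then have "(\<lambda>n. norm (H (x n) - H l)) \<longlonglongrightarrow> 0"
    by (simp add: tendsto_norm_zero LIM_zero)
  moreover have "norm (u n - H l (u n)) \<le> norm (H (x n) - H l)" for n
  proof -
    have "u n - H l (u n) = (H (x n) - H l) (u n)" using u(2)[of n] by (simp add: blinfun.diff_left)
    then show ?thesis using norm_blinfun[of "H (x n) - H l" "u n"] u(1) by simp
  qed
  ultimately have "(\<lambda>n. u n - H l (u n)) \<longlonglongrightarrow> 0"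
    by (intro Lim_null_comparison[of "\<lambda>n. u n - H l (u n)" "\<lambda>n. norm (H (x n) - H l)"]) auto
  from fixed_vector_of_approximate_fixed_vectors[OF blinfun.bounded_linear_right comp u(1) this]
  show "l \<in> {x. \<exists>y. y \<noteq> 0 \<and> y = H x y}" by (rule CollectI)
qed

text \<open>The factor \<lambda> is absorbed into \<open>G\<close>, \<open>g\<close> and
  \<open>H\<close>. Its upper bound survives as quadratic growth with \<open>m < 1\<close>, its
  lower bound as one negative value of the form.\<close>

lemma singular_set_closed_not_sigma_compact:
  fixes G :: "'a::{real_inner, complete_space} \<Rightarrow> real"
    and H :: "'a \<Rightarrow> ('a \<Rightarrow>\<^sub>L 'a)"
  assumes inf_dim: "\<not> (\<exists>B :: 'a set. finite B \<and> span B = UNIV)"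
    and G1: "\<And>x. (G has_derivative (\<lambda>h. inner (g x) h)) (at x)"
    and G2: "\<And>x. (g has_derivative blinfun_apply (H x)) (at x)"
    and cont: "continuous_on UNIV H"
    and cg: "compact_map g"
    and growth: "m < 1" "\<And>x. G x \<le> D + m / 2 * (norm x)\<^sup>2"
    and neg: "inner (y0 - H x0 y0) y0 < 0"
  shows "closed {x. \<exists>y. y \<noteq> 0 \<and> y = H x y} \<and> \<not> sigma_compact {x. \<exists>y. y \<noteq> 0 \<and> y = H x y}"
proof -
  define S where "S = {x. \<exists>y. y \<noteq> 0 \<and> y = H x y}"
  define U where "U = {x. \<exists>y. inner (y - H x y) y < 0}"
  define P where "P = {x. \<exists>c>0. \<forall>y. c * (norm y)\<^sup>2 \<le> inner (y - H x y) y}"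
  have comp: "compact (closure (H x ` cball 0 1))" for x
    by (rule compact_derivative_of_compact_map[OF cg G2])
  have sym: "inner (H x u) v = inner (H x v) u" for x u v
    by (rule second_derivative_symmetric[OF G1 G2])
  have "open U"
  proof -
    have "open {x. inner (y - H x y) y < 0}" for y
      by (intro open_Collect_less continuous_intros blinfun.continuous_on cont)
    moreover have "U = (\<Union>y. {x. inner (y - H x y) y < 0})" unfolding U_def by blast
    ultimately show ?thesis by auto
  qed
  \<comment> \<open>Changing the operator by less than \<open>c / 2\<close> in norm leaves the
    coercivity constant \<open>c / 2\<close>.\<close>
  have "open P"
    unfolding open_dist
  proof
    fix x assume "x \<in> P"
    then obtain c where c: "c > 0" "\<And>y. c * (norm y)\<^sup>2 \<le> inner (y - H x y) y"
      unfolding P_def by blast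
    obtain e where e: "e > 0" "\<And>z. dist z x < e \<Longrightarrow> dist (H z) (H x) < c / 2"
      using cont half_gt_zero[OF c(1)] unfolding continuous_on_iff by blast
    have "z \<in> P" if "dist z x < e" for z
    proof -
      have "c / 2 * (norm y)\<^sup>2 \<le> inner (y - H z y) y" for y
      proof -
        have "inner ((H z - H x) y) y \<le> norm ((H z - H x) y) * norm y" by (rule norm_cauchy_schwarz)
        also have "\<dots> \<le> norm (H z - H x) * norm y * norm y"
          by (intro mult_right_mono norm_blinfun) auto
        also have "\<dots> \<le> c / 2 * norm y * norm y"
          using e(2)[OF that] by (intro mult_right_mono) (auto simp: dist_norm)
        finally have "inner (H z y) y - inner (H x y) y \<le> c / 2 * (norm y)\<^sup>2"
          by (simp add: blinfun.diff_left inner_diff_left power2_eq_square mult.assoc)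
        moreover have "c * (norm y)\<^sup>2 = c / 2 * (norm y)\<^sup>2 + c / 2 * (norm y)\<^sup>2" by simp
        ultimately show ?thesis using c(2)[of y] unfolding inner_diff_left by linarith
      qed
      then show ?thesis unfolding P_def using c(1) half_gt_zero by blast
    qed
    then show "\<exists>e>0. \<forall>z. dist z x < e \<longrightarrow> z \<in> P" using e(1) by blast
  qed
  have cover: "- S \<subseteq> U \<union> P"
  proof
    fix x assume x: "x \<in> - S"
    show "x \<in> U \<union> P"
    proof (cases "x \<in> U")
      case False
      then have "0 \<le> inner (y - H x y) y" for y unfolding U_def by (simp add: not_less)
      moreover have "y = 0" if "y = H x y" for y using x that unfolding S_def by blast
      ultimately have "x \<in> P"
        unfolding P_def using coercive_of_nonneg_injective[OF blinfun.bounded_linear_right comp sym] by blast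
      then show ?thesis by simp
    qed simp
  qed
  have disj: "U \<inter> P = {}"
  proof (rule ccontr)
    assume "U \<inter> P \<noteq> {}"
    then obtain x y c where "inner (y - H x y) y < 0" "c > 0" "c * (norm y)\<^sup>2 \<le> inner (y - H x y) y"
      unfolding U_def P_def by blast
    moreover have "0 \<le> c * (norm y)\<^sup>2" using \<open>c > 0\<close> by simp
    ultimately show False by linarith
  qed
  have "\<not> sigma_compact S"
  proof
    assume sc: "sigma_compact S"
    have "U \<inter> - S \<noteq> {}"
    proof
      assume "U \<inter> - S = {}"
      then have "U \<subseteq> interior S" using \<open>open U\<close> by (intro interior_maximal) auto
      then have "U = {}" using interior_sigma_compact_infinite_dim[OF inf_dim sc] by blast
      then show False using neg unfolding U_def by blast
    qed
    \<comment> \<open>\<open>U\<close> and \<open>P\<close> are disjoint open sets covering the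
      connected set \<open>- S\<close>; as \<open>U\<close> meets it, \<open>P\<close>
      cannot.\<close>
    then have PS: "P \<inter> - S = {}"
      using connectedD[OF connected_Compl_sigma_compact[OF inf_dim sc] \<open>open U\<close> \<open>open P\<close>] cover disj by blast
    have "v \<in> (\<lambda>x. x - g x) ` S" for v
    proof -
      obtain x where x: "\<And>y. inner x x / 2 - G x - inner v x \<le> inner y y / 2 - G y - inner v y"
        using tilted_quadratic_has_minimizer[OF G1 cg growth] by blast
      have grad: "((\<lambda>x. inner x x / 2 - G x - inner v x) has_derivative (\<lambda>h. inner (x - g x - v) h)) (at x)" for x
        by (rule tilted_quadratic_has_gradient[OF G1])
      have "((\<lambda>x. x - g x - v) has_derivative (\<lambda>y. y - H x y)) (at x)"
        using G2 by (auto intro!: derivative_eq_intros)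
      note min = second_order_necessary_condition[OF grad this x]
      \<comment> \<open>The second-order condition at the minimizer excludes negative values.
        Outside \<open>S\<close> only \<open>P\<close> would remain, and \<open>P\<close> lies
        inside \<open>S\<close>.\<close>
      have "x \<notin> U" unfolding U_def using min(2) by (auto simp: not_less)
      then have "x \<in> S" using PS cover by blast
      moreover have "v = x - g x" using min(1) by simp
      ultimately show ?thesis by (rule rev_image_eqI)
    qed
    then have "(\<lambda>x. x - g x) ` S = UNIV" by blast
    moreover have "continuous_on S (\<lambda>x. x - g x)"
      using cg unfolding compact_map_def by (auto intro!: continuous_intros intro: continuous_on_subset)
    ultimately have "sigma_compact (UNIV :: 'a set)" using sigma_compact_continuous_image[OF sc] by metis
    then have "interior (UNIV :: 'a set) = {}" by (rule interior_sigma_compact_infinite_dim[OF inf_dim])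
    then show False by simp
  qed
  then show ?thesis using closed_fixed_vector_parameters[OF cont comp] unfolding S_def by blast
qed

section \<open>Quadratic growth from the limsup condition\<close>

text \<open>Balls need not be compact here, so the bound comes from the gradient: it is bounded on
  balls, and the mean value theorem applies on the segment from \<open>0\<close> to
  \<open>x\<close>.\<close>

lemma bounded_above_on_ball_of_compact_gradient:
  fixes G :: "'a::real_inner \<Rightarrow> real"
  assumes G1: "\<And>x. (G has_derivative (\<lambda>h. inner (g x) h)) (at x)"
    and cg: "compact_map g"
  shows "\<exists>D. \<forall>x. norm x \<le> b \<longrightarrow> G x \<le> D"
proof -
  have "bounded (g ` cball 0 b)"
    using cg unfolding compact_map_def
    by (meson bounded_cball bounded_subset closure_subset compact_imp_bounded)
  then obtain C where "\<forall>x\<in>cball 0 b. norm (g x) \<le> C" unfolding bounded_iff by auto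
  then have C: "norm (g x) \<le> C" if "norm x \<le> b" for x using that by simp
  have "G x \<le> G 0 + C * b" if x: "norm x \<le> b" for x
  proof -
    have "(0::real) < 1" by simp
    from MVT2[OF this has_real_derivative_along_line[OF G1, where x = 0 and h = x]]
    obtain z where z: "0 < z" "z < 1" "G (0 + 1 *\<^sub>R x) - G (0 + 0 *\<^sub>R x) = (1 - 0) * inner (g (0 + z *\<^sub>R x)) x"
      by blast
    have "norm (z *\<^sub>R x) \<le> norm x" using z by (simp add: mult_left_le_one_le)
    then have "norm (g (z *\<^sub>R x)) \<le> C" using C x by simp
    then have "norm (g (z *\<^sub>R x)) * norm x \<le> C * b" using x by (intro mult_mono) (auto intro: order_trans[OF norm_ge_zero])
    then have "inner (g (z *\<^sub>R x)) x \<le> C * b" using norm_cauchy_schwarz[of "g (z *\<^sub>R x)" x] by linarith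
    then show ?thesis using z(3) by simp
  qed
  then show ?thesis by blast
qed

text \<open>The limsup controls \<open>J\<close> outside a ball, and the compact gradient bounds it
  above inside.\<close>

lemma quadratic_growth_of_Limsup:
  fixes J :: "'a::real_inner \<Rightarrow> real"
  assumes J1: "\<And>x. (J has_derivative (\<lambda>h. inner (J' x) h)) (at x)"
    and cJ: "compact_map J'"
    and m: "0 < m" "2 * Limsup at_infinity (\<lambda>x. ereal (J x / (norm x)\<^sup>2)) < ereal m"
  shows "\<exists>D. \<forall>x. J x \<le> D + m / 2 * (norm x)\<^sup>2"
proof -
  have "Limsup at_infinity (\<lambda>x. ereal (J x / (norm x)\<^sup>2)) < ereal (m / 2)"
    using m(2) by (cases "Limsup at_infinity (\<lambda>x. ereal (J x / (norm x)\<^sup>2))") auto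
  then have "\<forall>\<^sub>F x in at_infinity. ereal (J x / (norm x)\<^sup>2) < ereal (m / 2)" by (rule Limsup_lessD)
  then obtain b where b: "\<And>x. b \<le> norm x \<Longrightarrow> J x / (norm x)\<^sup>2 < m / 2"
    unfolding eventually_at_infinity by auto
  \<comment> \<open>The radius is at least 1, so outside the ball the norm is positive and the
    quotient can be cleared.\<close>
  obtain D where D: "\<And>x. norm x \<le> max b 1 \<Longrightarrow> J x \<le> D"
    using bounded_above_on_ball_of_compact_gradient[OF J1 cJ] by blast
  \<comment> \<open>The constant is made nonnegative so that it does no harm outside the
    ball.\<close>
  have "J x \<le> max D 0 + m / 2 * (norm x)\<^sup>2" for x
  proof (cases "norm x \<le> max b 1")
    case True
    have "0 \<le> m / 2 * (norm x)\<^sup>2" using m(1) by simp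
    then show ?thesis using D[OF True] by linarith
  next
    case False
    then have "b \<le> norm x" "norm x > 0" by auto
    then have "J x < m / 2 * (norm x)\<^sup>2" using b[of x] by (simp add: divide_less_eq)
    then show ?thesis by linarith
  qed
  then show ?thesis by blast
qed

lemma compact_map_scaleR:
  assumes "compact_map f"
  shows "compact_map (\<lambda>x. c *\<^sub>R f x)"
proof -
  have "closure ((\<lambda>x. c *\<^sub>R f x) ` S) = (*\<^sub>R) c ` closure (f ` S)" for S
    by (simp add: closure_scaleR image_image)
  then show ?thesis
    using assms unfolding compact_map_def by (auto intro!: continuous_intros compact_scaling)
qed

section \<open>Reduction of the theorem to the rescaled functional\<close>

theorem theorem2:
  fixes J :: "'a::{real_inner, complete_space} \<Rightarrow> real"
    and J' :: "'a \<Rightarrow> 'a"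
    and J'' :: "'a \<Rightarrow> ('a \<Rightarrow>\<^sub>L 'a)"
    and lam :: real and M :: ereal
  assumes inf_dim: "\<not> (\<exists>B :: 'a set. finite B \<and> span B = UNIV)"
    and J1: "\<And>x. (J has_derivative (\<lambda>h. inner (J' x) h)) (at x)"
    and J2: "\<And>x. (J' has_derivative blinfun_apply (J'' x)) (at x)"
    and J2_cont: "continuous_on UNIV J''"
    and J'_compact: "compact_map J'"
    and M_def: "M = max 0 (max (2 * Limsup at_infinity (\<lambda>x. ereal (J x / (norm x)\<^sup>2)))
                              (Limsup at_infinity (\<lambda>x. ereal (inner (J' x) x / (norm x)\<^sup>2))))"
    and M_lt: "M < (SUP p \<in> {(x, y). y \<noteq> 0}. ereal (inner (J'' (fst p) (snd p)) (snd p) / (norm (snd p))\<^sup>2))"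
    and lam_lower: "(INF p \<in> {(x, y). inner (J'' x y) y > 0}. ereal ((norm (snd p))\<^sup>2 / inner (J'' (fst p) (snd p)) (snd p))) < ereal lam"
    and lam_upper: "ereal lam < ereal_recip M"
  shows "closed {x. \<exists>y. y \<noteq> 0 \<and> y = lam *\<^sub>R (J'' x y)} \<and>
         \<not> sigma_compact {x. \<exists>y. y \<noteq> 0 \<and> y = lam *\<^sub>R (J'' x y)}"
proof -
  obtain x0 y0 where xy: "inner (J'' x0 y0) y0 > 0" "(norm y0)\<^sup>2 / inner (J'' x0 y0) y0 < lam"
    using lam_lower unfolding INF_less_iff by auto
  have "0 \<le> (norm y0)\<^sup>2 / inner (J'' x0 y0) y0" using xy(1) by simp
  then have lam: "lam > 0" using xy(2) by linarith
  \<comment> \<open>\<open>M\<close> is real: it is nonnegative by definition and strictly below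
    some extended real.\<close>
  obtain \<mu> where \<mu>: "M = ereal \<mu>" "\<mu> \<ge> 0"
  proof -
    have "0 \<le> M"
    unfolding M_def by (intro max.coboundedI2 max.coboundedI1 order_refl)
    moreover have "M \<noteq> \<infinity>" using M_lt by auto
    ultimately show ?thesis using that by (cases M) auto
  qed
  have "\<mu> < 1 / lam"
    using lam_upper lam \<mu> by (auto simp: ereal_recip_def field_simps split: if_splits)
  \<comment> \<open>The strict gap makes \<open>m\<close> positive with \<open>lam * m < 1\<close>,
    and leaves room to pass from a limsup to a pointwise bound. It is present also when
    \<open>M = 0\<close>, where the reciprocal is infinite.\<close>
  then obtain m where m: "\<mu> < m" "m < 1 / lam" using dense by blast
  have "2 * Limsup at_infinity (\<lambda>x. ereal (J x / (norm x)\<^sup>2)) \<le> M"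
    unfolding M_def by (intro max.coboundedI2 max.coboundedI1 order_refl)
  also have "M < ereal m" using \<mu>(1) m(1) by simp
  finally have "\<exists>D. \<forall>x. J x \<le> D + m / 2 * (norm x)\<^sup>2"
    by (rule quadratic_growth_of_Limsup[OF J1 J'_compact le_less_trans[OF \<mu>(2) m(1)]])
  then obtain D where D: "\<And>x. J x \<le> D + m / 2 * (norm x)\<^sup>2" by blast
  have "closed {x. \<exists>y. y \<noteq> 0 \<and> y = (lam *\<^sub>R J'' x) y} \<and> \<not> sigma_compact {x. \<exists>y. y \<noteq> 0 \<and> y = (lam *\<^sub>R J'' x) y}"
  proof (rule singular_set_closed_not_sigma_compact[OF inf_dim])
    show "((\<lambda>x. lam * J x) has_derivative (\<lambda>h. inner (lam *\<^sub>R J' x) h)) (at x)" for x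
      using has_derivative_mult_right[OF J1[of x], of lam] by simp
    show "((\<lambda>x. lam *\<^sub>R J' x) has_derivative blinfun_apply (lam *\<^sub>R J'' x)) (at x)" for x
      using has_derivative_scaleR_right[OF J2[of x], of lam] by (simp add: scaleR_blinfun.rep_eq)
    show "continuous_on UNIV (\<lambda>x. lam *\<^sub>R J'' x)" by (intro continuous_intros J2_cont)
    show "compact_map (\<lambda>x. lam *\<^sub>R J' x)" by (rule compact_map_scaleR[OF J'_compact])
    show "lam * m < 1" using m(2) lam by (simp add: field_simps)
    show "lam * J x \<le> lam * D + lam * m / 2 * (norm x)\<^sup>2" for x
      using mult_left_mono[OF D[of x], of lam] lam by (simp add: algebra_simps)
    \<comment> \<open>The pair found below the infimum bound is a point and a direction where the
      form of the rescaled operator is negative.\<close>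
    have "inner y0 y0 < lam * inner (J'' x0 y0) y0"
      using xy(2) by (simp only: pos_divide_less_eq[OF xy(1)] power2_norm_eq_inner)
    then show "inner (y0 - (lam *\<^sub>R J'' x0) y0) y0 < 0"
      by (simp add: blinfun.scaleR_left inner_diff_left)
  qed
  then show ?thesis unfolding blinfun.scaleR_left .
qed

end
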